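(* Let $\mathcal M$ be a time-like W-surface in $\mathbb R^3_1$ and let $a\neq0$ be a constant. Then the natural PDE of $\mathcal M$ is the natural PDE of the parallel time-like surface $\overline{\mathcal M}(a)$ of $\mathcal M$.
   Context: $\mathbb R^3_1$ is $\mathbb R^3$ with the flat metric $\langle x,y\rangle=x_1y_1+x_2y_2-x_3y_3$. Functions are assumed sufficiently smooth. For a time-like surface $z=z(u,v)$ let $l$ be the unit normal field, $\langle l,l\rangle=1$, and $E=\langle z_u,z_u\rangle<0$, $F=\langle z_u,z_v\rangle$, $G=\langle z_v,z_v\rangle>0$, $L=\langle l,z_{uu}\rangle$, $M=\langle l,z_{uv}\rangle$, $N=\langle l,z_{vv}\rangle$. Parameters are principal if $F=M=0$; then the principal curvatures are $\nu_1=L/E$, $\nu_2=N/G$, and all surfaces considered have distinct real principal curvatures. The surface is a Weingarten surface (W-surface) with Weingarten functions $f,g$ if $f(\nu),g(\nu)$, $\nu\in\mathcal I$ (an interval), are differentiable functions with $f-g\ne0$, $f'g'\neq0$, and there is a function $\nu=\nu(u,v)$ such that $\nu_1=f(\nu)$, $\nu_2=g(\nu)$. Principal parameters $(u,v)$ on a Weingarten surface are natural principal if both functions $\sqrt{-E}\,\exp\left(\int\frac{f'd\nu}{f-g}\right)$ and $\sqrt G\,\exp\left(\int\frac{g'd\nu}{g-f}\right)$ are constant. Let $(u,v)\in\mathcal D$ be natural principal parameters on $\mathcal M$, $(u_0,v_0)\in\mathcal D$ fixed, $\nu_0=\nu(u_0,v_0)$, and let $\mathfrak a,\mathfrak b>0$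 be given by $E(u_0,v_0)=-\mathfrak a^{-2}$, $G(u_0,v_0)=\mathfrak b^{-2}$. The natural PDE of $\mathcal M$ is the equation for $\nu=\nu(u,v)$ $$\mathfrak a^2\exp\left(2\int_{\nu_0}^{\nu}\frac{f'd\nu}{f-g}\right)\left[g'\nu_{uu}+\left(g''-\frac{2g'^2}{g-f}\right)\nu_u^2\right]+\mathfrak b^2\exp\left(2\int_{\nu_0}^{\nu}\frac{g'd\nu}{g-f}\right)\left[f'\nu_{vv}+\left(f''-\frac{2f'^2}{f-g}\right)\nu_v^2\right]=fg(f-g).$$ For a constant $a\neq0$ the parallel surface $\overline{\mathcal M}(a)$ is $\bar z=z+a\,l$, points where $(1-a\nu_1)(1-a\nu_2)=0$ being excluded. It is time-like; its unit normal is $\bar l=\varepsilon l$, $\varepsilon=\mathrm{sign}\,(1-a\nu_1)(1-a\nu_2)$; the same $(u,v)$ are natural principal parameters on it; its Weingarten functions with respect to the same $\nu(u,v)$ are $\bar f=\frac{\varepsilon f}{1-af}$, $\bar g=\frac{\varepsilon g}{1-ag}$; and its coefficients are $\bar E=(1-a\nu_1)^2E$, $\bar G=(1-a\nu_2)^2G$. Its natural PDE is the equation above formed with $\bar f,\bar g$ in place of $f,g$ and with constants $\bar{\mathfrak a},\bar{\mathfrak b}>0$ given by $\bar E(u_0,v_0)=-\bar{\mathfrak a}^{-2}$, $\bar G(u_0,v_0)=\bar{\mathfrak b}^{-2}$, in place of $\mathfrak a,\mathfrak b$. Two PDE's for $\nu(u,v)$ are regarded as the same if they are equivalent, i.e.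 differ by a nowhere vanishing factor. *)

theory Defs
  imports "HOL-Analysis.Analysis"
begin

section \<open>Minkowski space and partial derivatives\<close>

definition mink :: "real^3 \<Rightarrow> real^3 \<Rightarrow> real" where
  "mink x y = x$1 * y$1 + x$2 * y$2 - x$3 * y$3"

definition du :: "(real \<times> real \<Rightarrow> 'a::real_normed_vector) \<Rightarrow> real \<times> real \<Rightarrow> 'a" where
  "du h p = vector_derivative (\<lambda>s. h (s, snd p)) (at (fst p))"

definition dv :: "(real \<times> real \<Rightarrow> 'a::real_normed_vector) \<Rightarrow> real \<times> real \<Rightarrow> 'a" where
  "dv h p = vector_derivative (\<lambda>t. h (fst p, t)) (at (snd p))"

text \<open>Class \<open>C\<^sup>k\<close>; meant for open \<open>S\<close>.\<close>

primrec Ck_on :: "nat \<Rightarrow> (real \<times> real) set \<Rightarrow> (real \<times> real \<Rightarrow> 'a::real_normed_vector) \<Rightarrow> bool" where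
  "Ck_on 0 S h \<longleftrightarrow> continuous_on S h"
| "Ck_on (Suc k) S h \<longleftrightarrow> h differentiable_on S \<and> Ck_on k S (du h) \<and> Ck_on k S (dv h)"

text \<open>For functions of one variable on an interval \<open>I\<close> that may contain its endpoints,
  derivatives are taken relative to \<open>I\<close> (one-sided at endpoints).\<close>

definition D1 :: "real set \<Rightarrow> (real \<Rightarrow> real) \<Rightarrow> real \<Rightarrow> real" where
  "D1 I f x = vector_derivative f (at x within I)"

definition C2_fun :: "real set \<Rightarrow> (real \<Rightarrow> real) \<Rightarrow> bool" where
  "C2_fun I f \<longleftrightarrow> f differentiable_on I \<and> D1 I f differentiable_on I \<and>
     continuous_on I (D1 I (D1 I f))"


section \<open>Time-like surfaces\<close>

type_synonym surf = "real \<times> real \<Rightarrow> real^3"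

definition cE :: "surf \<Rightarrow> real \<times> real \<Rightarrow> real" where "cE z p = mink (du z p) (du z p)"
definition cF :: "surf \<Rightarrow> real \<times> real \<Rightarrow> real" where "cF z p = mink (du z p) (dv z p)"
definition cG :: "surf \<Rightarrow> real \<times> real \<Rightarrow> real" where "cG z p = mink (dv z p) (dv z p)"

definition cL :: "surf \<Rightarrow> surf \<Rightarrow> real \<times> real \<Rightarrow> real" where "cL z l p = mink (l p) (du (du z) p)"
definition cM :: "surf \<Rightarrow> surf \<Rightarrow> real \<times> real \<Rightarrow> real" where "cM z l p = mink (l p) (dv (du z) p)"
definition cN :: "surf \<Rightarrow> surf \<Rightarrow> real \<times> real \<Rightarrow> real" where "cN z l p = mink (l p) (dv (dv z) p)"

text \<open>The inequalities \<open>E < 0 < G\<close> imply that \<open>z\<^sub>u\<close>, \<open>z\<^sub>v\<close> are linearly independent and that the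
  induced metric is indefinite. Either of the two unit normal fields is allowed as \<open>l\<close>.\<close>

definition timelike_surface :: "(real \<times> real) set \<Rightarrow> surf \<Rightarrow> surf \<Rightarrow> bool" where
  "timelike_surface D z l \<longleftrightarrow>
     D \<noteq> {} \<and> open D \<and> connected D \<and> Ck_on 2 D z \<and> Ck_on 2 D l \<and>
     (\<forall>p\<in>D. cE z p < 0 \<and> cG z p > 0) \<and>
     (\<forall>p\<in>D. mink (l p) (l p) = 1 \<and> mink (l p) (du z p) = 0 \<and> mink (l p) (dv z p) = 0)"

definition principal_params :: "(real \<times> real) set \<Rightarrow> surf \<Rightarrow> surf \<Rightarrow> bool" where
  "principal_params D z l \<longleftrightarrow> (\<forall>p\<in>D. cF z p = 0 \<and> cM z l p = 0)"

definition curv1 :: "surf \<Rightarrow> surf \<Rightarrow> real \<times> real \<Rightarrow> real" where "curv1 z l p = cL z l p / cE z p"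
definition curv2 :: "surf \<Rightarrow> surf \<Rightarrow> real \<times> real \<Rightarrow> real" where "curv2 z l p = cN z l p / cG z p"


section \<open>Weingarten surfaces and natural principal parameters\<close>

definition weingarten_functions :: "real set \<Rightarrow> (real \<Rightarrow> real) \<Rightarrow> (real \<Rightarrow> real) \<Rightarrow> bool" where
  "weingarten_functions I f g \<longleftrightarrow>
     is_interval I \<and> interior I \<noteq> {} \<and> C2_fun I f \<and> C2_fun I g \<and>
     (\<forall>x\<in>I. f x - g x \<noteq> 0 \<and> D1 I f x * D1 I g x \<noteq> 0)"

definition W_surface ::
  "(real \<times> real) set \<Rightarrow> surf \<Rightarrow> surf \<Rightarrow> real set \<Rightarrow> (real \<Rightarrow> real) \<Rightarrow> (real \<Rightarrow> real) \<Rightarrow>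
   (real \<times> real \<Rightarrow> real) \<Rightarrow> bool" where
  "W_surface D z l I f g \<nu> \<longleftrightarrow>
     timelike_surface D z l \<and> principal_params D z l \<and> weingarten_functions I f g \<and>
     Ck_on 2 D \<nu> \<and>
     (\<forall>p\<in>D. \<nu> p \<in> I \<and> curv1 z l p = f (\<nu> p) \<and> curv2 z l p = g (\<nu> p))"

text \<open>\<open>wint I f g x\<^sub>0 x\<close> is the oriented integral of \<open>f' / (f - g)\<close> from \<open>x\<^sub>0\<close> to \<open>x\<close>;
  \<open>wint I g f\<close> has \<open>g' / (g - f)\<close>.\<close>

definition wint :: "real set \<Rightarrow> (real \<Rightarrow> real) \<Rightarrow> (real \<Rightarrow> real) \<Rightarrow> real \<Rightarrow> real \<Rightarrow> real" where
  "wint I f g x\<^sub>0 x = (LBINT t=ereal x\<^sub>0..ereal x. D1 I f t / (f t - g t))"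

text \<open>The indefinite integrals are determined up to a constant, so constancy does not depend on
  the lower limit \<open>x\<^sub>0\<close>.\<close>

definition natural_params ::
  "(real \<times> real) set \<Rightarrow> surf \<Rightarrow> real set \<Rightarrow> (real \<Rightarrow> real) \<Rightarrow> (real \<Rightarrow> real) \<Rightarrow>
   (real \<times> real \<Rightarrow> real) \<Rightarrow> bool" where
  "natural_params D z I f g \<nu> \<longleftrightarrow>
     (\<forall>x\<^sub>0\<in>I.
        (\<lambda>p. sqrt (- cE z p) * exp (wint I f g x\<^sub>0 (\<nu> p))) constant_on D \<and>
        (\<lambda>p. sqrt (cG z p) * exp (wint I g f x\<^sub>0 (\<nu> p))) constant_on D)"

definition natural_W_surface ::
  "(real \<times> real) set \<Rightarrow> surf \<Rightarrow> surf \<Rightarrow> real set \<Rightarrow> (real \<Rightarrow> real) \<Rightarrow> (real \<Rightarrow> real) \<Rightarrow>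
   (real \<times> real \<Rightarrow> real) \<Rightarrow> bool" where
  "natural_W_surface D z l I f g \<nu> \<longleftrightarrow> W_surface D z l I f g \<nu> \<and> natural_params D z I f g \<nu>"


section \<open>The natural PDE\<close>

text \<open>A PDE for an unknown \<open>\<phi>(u,v)\<close> is represented by the differential expression
  (left-hand side minus right-hand side), sending \<open>\<phi>\<close> and a point to a number; the
  equation says that this vanishes.\<close>

type_synonym pde = "(real \<times> real \<Rightarrow> real) \<Rightarrow> real \<times> real \<Rightarrow> real"

definition natural_pde_expr ::
  "real set \<Rightarrow> (real \<Rightarrow> real) \<Rightarrow> (real \<Rightarrow> real) \<Rightarrow> real \<Rightarrow> real \<Rightarrow> real \<Rightarrow> pde" where
  "natural_pde_expr I f g \<nu>\<^sub>0 \<aa> \<bb> = (\<lambda>\<phi> p. let x = \<phi> p in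
     \<aa>\<^sup>2 * exp (2 * wint I f g \<nu>\<^sub>0 x) *
       (D1 I g x * du (du \<phi>) p +
        (D1 I (D1 I g) x - 2 * (D1 I g x)\<^sup>2 / (g x - f x)) * (du \<phi> p)\<^sup>2)
     + \<bb>\<^sup>2 * exp (2 * wint I g f \<nu>\<^sub>0 x) *
       (D1 I f x * dv (dv \<phi>) p +
        (D1 I (D1 I f) x - 2 * (D1 I f x)\<^sup>2 / (f x - g x)) * (dv \<phi> p)\<^sup>2)
     - f x * g x * (f x - g x))"

text \<open>The constants are the positive numbers with \<open>E(p\<^sub>0) = - \<aa>\<^sup>-\<^sup>2\<close> and \<open>G(p\<^sub>0) = \<bb>\<^sup>-\<^sup>2\<close>.\<close>

definition natural_pde ::
  "surf \<Rightarrow> real set \<Rightarrow> (real \<Rightarrow> real) \<Rightarrow> (real \<Rightarrow> real) \<Rightarrow> (real \<times> real \<Rightarrow> real) \<Rightarrow>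
   real \<times> real \<Rightarrow> pde" where
  "natural_pde z I f g \<nu> p\<^sub>0 =
     natural_pde_expr I f g (\<nu> p\<^sub>0) (1 / sqrt (- cE z p\<^sub>0)) (1 / sqrt (cG z p\<^sub>0))"

text \<open>Two PDEs are the same, for unknowns with values in \<open>J\<close>, if they differ by a nowhere vanishing
  factor. The factor is a continuous function of the value of the unknown; an arbitrary
  dependence on the derivatives of the unknown would only compare the zero sets.\<close>

definition same_pde :: "real set \<Rightarrow> pde \<Rightarrow> pde \<Rightarrow> bool" where
  "same_pde J P Q \<longleftrightarrow>
     (\<exists>c. continuous_on J c \<and> (\<forall>x\<in>J. c x \<noteq> 0) \<and>
        (\<forall>U \<phi>. open U \<longrightarrow> Ck_on 2 U \<phi> \<longrightarrow> \<phi> ` U \<subseteq> J \<longrightarrow>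
           (\<forall>p\<in>U. Q \<phi> p = c (\<phi> p) * P \<phi> p)))"


section \<open>The parallel surface\<close>

definition par_surf :: "real \<Rightarrow> surf \<Rightarrow> surf \<Rightarrow> surf" where
  "par_surf a z l = (\<lambda>p. z p + a *\<^sub>R l p)"

definition par_normal :: "real \<Rightarrow> surf \<Rightarrow> surf \<Rightarrow> surf" where
  "par_normal a z l = (\<lambda>p. sgn ((1 - a * curv1 z l p) * (1 - a * curv2 z l p)) *\<^sub>R l p)"

text \<open>After exclusion of the singular points, the parallel surface is considered on the connected
  component containing the base point, and its Weingarten functions on the corresponding
  maximal interval, on which the sign is constant.\<close>

definition par_dom :: "real \<Rightarrow> (real \<times> real) set \<Rightarrow> surf \<Rightarrow> surf \<Rightarrow> real \<times> real \<Rightarrow> (real \<times> real) set" where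
  "par_dom a D z l p\<^sub>0 =
     connected_component_set {p\<in>D. (1 - a * curv1 z l p) * (1 - a * curv2 z l p) \<noteq> 0} p\<^sub>0"

definition par_interval :: "real \<Rightarrow> real set \<Rightarrow> (real \<Rightarrow> real) \<Rightarrow> (real \<Rightarrow> real) \<Rightarrow> real \<Rightarrow> real set" where
  "par_interval a I f g x\<^sub>0 =
     connected_component_set {x\<in>I. (1 - a * f x) * (1 - a * g x) \<noteq> 0} x\<^sub>0"

text \<open>\<open>par_fun a f g\<close> is the first Weingarten function of the parallel surface and
  \<open>par_fun a g f\<close> the second.\<close>

definition par_fun :: "real \<Rightarrow> (real \<Rightarrow> real) \<Rightarrow> (real \<Rightarrow> real) \<Rightarrow> real \<Rightarrow> real" where
  "par_fun a f g = (\<lambda>x. sgn ((1 - a * f x) * (1 - a * g x)) * f x / (1 - a * f x))"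

end

theory Submission
  imports Defs
begin

text \<open>By the Rodrigues formulas \<open>l\<^sub>u = - \<nu>\<^sub>1 z\<^sub>u\<close>, \<open>l\<^sub>v = - \<nu>\<^sub>2 z\<^sub>v\<close>, the parallel surface has
  \<open>z\<^sub>u\<close>, \<open>z\<^sub>v\<close> multiplied by \<open>1 - a f\<close>, \<open>1 - a g\<close>. Since \<open>1 - a g = (1 - a f) + a (f - g)\<close>, the integral
  of \<open>f' / (f - g)\<close> changes by \<open>- ln \<bar>1 - a f\<bar>\<close> up to a constant, which compensates the change of \<open>E\<close>;
  the same identity shows that each of the three groups of terms of the natural PDE acquires the
  factor \<open>\<epsilon> / ((1 - a f)\<^sup>2 (1 - a g)\<^sup>2)\<close>.\<close>

section \<open>Partial derivatives\<close>

text \<open>Sameness of the PDEs is tested on every unknown with values in the interval, so the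
  comparison is an identity between coefficients in one real variable; the surface enters only
  through the two constants at the base point. The lower limit of the integral of f' / (f - g)
  leaves a factor (1 - a f(x0))^2 in the exponential weight, and the passage to the parallel surface
  divides the squared constant by the same number. The common factor is therefore independent of the
  base point. Two obstacles shape the rest. The interval may contain endpoints, where derivatives
  are one-sided, so restricting to the component without zeros of (1 - a f)(1 - a g) must be shown
  to leave all derivatives unchanged. And 1 - a f, 1 - a g may be negative, so square roots and
  logarithms produce absolute values; the constancy of the sign on the component keeps
  \<open>sgn\<close> from being differentiated. Exchanging f and g preserves both component and
  sign, so each one-variable computation is carried out for one function only.\<close>

lemma bounded_bilinear_mink: "bounded_bilinear mink"
proof -
  \<comment> \<open>Reflecting the time axis turns the form into the Euclidean inner product, from
    which boundedness is inherited.\<close>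
  define T :: "real^3 \<Rightarrow> real^3" where "T y = vector [y$1, y$2, - y$3]" for y
  have T: "bounded_linear T"
    unfolding T_def by (intro linear_conv_bounded_linear[THEN iffD1] linearI) (simp_all add: vec_eq_iff forall_3)
  have "mink = (\<lambda>x y. x \<bullet> T y)"
    by (intro ext) (simp add: mink_def T_def inner_vec_def sum_3)
  then show ?thesis
    using bounded_bilinear.comp[OF bounded_bilinear_inner bounded_linear_ident T] by simp
qed

lemmas mink_simps = bounded_bilinear.add_left[OF bounded_bilinear_mink]
  bounded_bilinear.add_right[OF bounded_bilinear_mink]
  bounded_bilinear.scaleR_left[OF bounded_bilinear_mink]
  bounded_bilinear.scaleR_right[OF bounded_bilinear_mink]

lemma mink_commute: "mink x y = mink y x"
  by (simp add: mink_def mult.commute)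

text \<open>Total differentiability on an open set restricts to the coordinate line, so
  \<open>du\<close> is a genuine derivative there and not an unspecified value.\<close>

lemma has_vector_derivative_du:
  assumes "h differentiable_on S" "open S" "p \<in> S"
  shows "((\<lambda>s. h (s, snd p)) has_vector_derivative du h p) (at (fst p))"
proof -
  have "h differentiable (at (fst p, snd p))"
    using assms by (simp add: differentiable_on_eq_differentiable_at)
  moreover have "(\<lambda>s. (s, snd p)) differentiable (at (fst p))"
    unfolding differentiable_def by (auto intro!: derivative_eq_intros)
  ultimately have "(h \<circ> (\<lambda>s. (s, snd p))) differentiable (at (fst p))"
    by (intro differentiable_chain_at) auto
  then show ?thesis
    unfolding du_def o_def by (simp add: vector_derivative_works)
qed

lemma has_vector_derivative_dv:
  assumes "h differentiable_on S" "open S" "p \<in> S"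
  shows "((\<lambda>t. h (fst p, t)) has_vector_derivative dv h p) (at (snd p))"
proof -
  have "h differentiable (at (fst p, snd p))"
    using assms by (simp add: differentiable_on_eq_differentiable_at)
  moreover have "(\<lambda>t. (fst p, t)) differentiable (at (snd p))"
    unfolding differentiable_def by (auto intro!: derivative_eq_intros)
  ultimately have "(h \<circ> (\<lambda>t. (fst p, t))) differentiable (at (snd p))"
    by (intro differentiable_chain_at) auto
  then show ?thesis
    unfolding dv_def o_def by (simp add: vector_derivative_works)
qed

lemma du_eqI: "((\<lambda>s. h (s, snd p)) has_vector_derivative d) (at (fst p)) \<Longrightarrow> du h p = d"
  unfolding du_def by (rule vector_derivative_at)

lemma dv_eqI: "((\<lambda>t. h (fst p, t)) has_vector_derivative d) (at (snd p)) \<Longrightarrow> dv h p = d"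
  unfolding dv_def by (rule vector_derivative_at)

text \<open>Openness of \<open>S\<close> keeps nearby points of the coordinate line in
  \<open>S\<close>. This permits differentiating relations such as <l, z_u> = 0, which are known
  only on the domain.\<close>

lemma du_cong:
  assumes "open S" "p \<in> S" "\<And>q. q \<in> S \<Longrightarrow> h q = k q"
  shows "du h p = du k p"
proof -
  have "((\<lambda>s. (s, snd p)) \<longlongrightarrow> (fst p, snd p)) (nhds (fst p))"
    by (intro tendsto_Pair tendsto_const tendsto_ident_at filterlim_ident)
  then have "\<forall>\<^sub>F s in nhds (fst p). (s, snd p) \<in> S"
    using assms by (intro topological_tendstoD) auto
  then show ?thesis
    unfolding du_def using assms(3) by (intro vector_derivative_cong_eq) (auto elim: eventually_mono)
qed

lemma dv_cong:
  assumes "open S" "p \<in> S" "\<And>q. q \<in> S \<Longrightarrow> h q = k q"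
  shows "dv h p = dv k p"
proof -
  have "((\<lambda>t. (fst p, t)) \<longlongrightarrow> (fst p, snd p)) (nhds (snd p))"
    by (intro tendsto_Pair tendsto_const tendsto_ident_at filterlim_ident)
  then have "\<forall>\<^sub>F t in nhds (snd p). (fst p, t) \<in> S"
    using assms by (intro topological_tendstoD) auto
  then show ?thesis
    unfolding dv_def using assms(3) by (intro vector_derivative_cong_eq) (auto elim: eventually_mono)
qed

lemma du_const [simp]: "du (\<lambda>q. c) p = 0" and dv_const [simp]: "dv (\<lambda>q. c) p = 0"
  by (auto simp: du_def dv_def)

lemma du_add:
  assumes "h differentiable_on S" "k differentiable_on S" "open S" "p \<in> S"
  shows "du (\<lambda>q. h q + k q) p = du h p + du k p"
  by (intro du_eqI has_vector_derivative_add has_vector_derivative_du[OF _ assms(3,4)] assms)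

lemma dv_add:
  assumes "h differentiable_on S" "k differentiable_on S" "open S" "p \<in> S"
  shows "dv (\<lambda>q. h q + k q) p = dv h p + dv k p"
  by (intro dv_eqI has_vector_derivative_add has_vector_derivative_dv[OF _ assms(3,4)] assms)

lemma du_linear:
  assumes "bounded_linear T" "h differentiable_on S" "open S" "p \<in> S"
  shows "du (\<lambda>q. T (h q)) p = T (du h p)"
  by (intro du_eqI bounded_linear.has_vector_derivative[OF assms(1)] has_vector_derivative_du[OF assms(2-4)])

lemma dv_linear:
  assumes "bounded_linear T" "h differentiable_on S" "open S" "p \<in> S"
  shows "dv (\<lambda>q. T (h q)) p = T (dv h p)"
  by (intro dv_eqI bounded_linear.has_vector_derivative[OF assms(1)] has_vector_derivative_dv[OF assms(2-4)])

lemma du_mink: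
  assumes "h differentiable_on S" "k differentiable_on S" "open S" "p \<in> S"
  shows "du (\<lambda>q. mink (h q) (k q)) p = mink (h p) (du k p) + mink (du h p) (k p)"
  using bounded_bilinear.has_vector_derivative[OF bounded_bilinear_mink
      has_vector_derivative_du[OF assms(1,3,4)] has_vector_derivative_du[OF assms(2-4)]]
  by (intro du_eqI) simp

lemma dv_mink:
  assumes "h differentiable_on S" "k differentiable_on S" "open S" "p \<in> S"
  shows "dv (\<lambda>q. mink (h q) (k q)) p = mink (h p) (dv k p) + mink (dv h p) (k p)"
  using bounded_bilinear.has_vector_derivative[OF bounded_bilinear_mink
      has_vector_derivative_dv[OF assms(1,3,4)] has_vector_derivative_dv[OF assms(2-4)]]
  by (intro dv_eqI) simp

section \<open>Closure properties of the class C^k and symmetry of mixed derivatives\<close>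

lemma Ck_on_cong:
  assumes "open S" "Ck_on n S h" "\<And>q. q \<in> S \<Longrightarrow> h q = k q"
  shows "Ck_on n S k"
  using assms(2,3)
proof (induction n arbitrary: h k)
  case 0
  then show ?case by (simp cong: continuous_on_cong)
next
  case (Suc n)
  have "h differentiable_on S \<longleftrightarrow> k differentiable_on S"
    using Suc.prems(2) unfolding differentiable_on_def differentiable_def
    by (metis has_derivative_transform)
  then show ?case
    using Suc.prems Suc.IH[of "du h" "du k"] Suc.IH[of "dv h" "dv k"] du_cong[OF assms(1)] dv_cong[OF assms(1)]
    by (metis Ck_on.simps(2))
qed

lemma Ck_on_subset:
  assumes "Ck_on n S h" "T \<subseteq> S"
  shows "Ck_on n T h"
  using assms by (induction n arbitrary: h) (auto intro: continuous_on_subset differentiable_on_subset)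

text \<open>The derivative of the sum equals the sum of the derivatives only on \<open>S\<close>, so
  the induction step passes through \<open>Ck_on_cong\<close>.\<close>

lemma Ck_on_add:
  assumes "open S" "Ck_on n S h" "Ck_on n S k"
  shows "Ck_on n S (\<lambda>q. h q + k q)"
  using assms(2,3)
proof (induction n arbitrary: h k)
  case 0
  then show ?case by (simp add: continuous_on_add)
next
  case (Suc n)
  then have "Ck_on n S (\<lambda>q. du h q + du k q)" "Ck_on n S (\<lambda>q. dv h q + dv k q)"
    by auto
  then show ?case
    using Suc.prems du_add[OF _ _ assms(1), of h k] dv_add[OF _ _ assms(1), of h k]
    by (auto intro: differentiable_on_add Ck_on_cong[OF assms(1)])
qed

lemma Ck_on_linear:
  assumes "bounded_linear T" "open S" "Ck_on n S h"
  shows "Ck_on n S (\<lambda>q. T (h q))"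
  using assms(3)
proof (induction n arbitrary: h)
  case 0
  then show ?case by (simp add: bounded_linear.continuous_on[OF assms(1)])
next
  case (Suc n)
  then have "Ck_on n S (\<lambda>q. T (du h q))" "Ck_on n S (\<lambda>q. T (dv h q))"
    by auto
  moreover have "(\<lambda>q. T (h q)) differentiable_on S"
    using Suc.prems differentiable_on_compose bounded_linear_imp_differentiable_on[OF assms(1)]
    by (metis Ck_on.simps(2))
  ultimately show ?case
    using Suc.prems du_linear[OF assms(1) _ assms(2), of h] dv_linear[OF assms(1) _ assms(2), of h]
    by (auto intro: Ck_on_cong[OF assms(2)])
qed

lemma Ck_on_2D:
  assumes "Ck_on 2 S h"
  shows "h differentiable_on S" "du h differentiable_on S" "dv h differentiable_on S"
    "continuous_on S (dv (du h))" "continuous_on S (du (dv h))"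
  using assms by (auto simp: numeral_2_eq_2)

lemma Ck_on_2_continuous: "Ck_on 2 S h \<Longrightarrow> continuous_on S h"
  by (simp add: Ck_on_2D differentiable_imp_continuous_on)

text \<open>Both mixed derivatives are values, at points close to \<open>p\<close>, of the second difference
  quotient over a small square with corner \<open>p\<close>.\<close>

lemma mixed_partials_real:
  fixes h :: "real \<times> real \<Rightarrow> real"
  assumes h: "Ck_on 2 S h" and S: "open S" "p \<in> S"
  shows "dv (du h) p = du (dv h) p"
proof (rule ccontr)
  assume ne: "dv (du h) p \<noteq> du (dv h) p"
  define e where "e = \<bar>dv (du h) p - du (dv h) p\<bar> / 2"
  have e: "e > 0" using ne by (simp add: e_def)
  obtain x y where p: "p = (x, y)" by fastforce
  obtain d0 where d0: "d0 > 0" "ball p d0 \<subseteq> S"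
    using S open_contains_ball by blast
  obtain d1 where d1: "d1 > 0" "\<And>q. q \<in> S \<Longrightarrow> dist q p < d1 \<Longrightarrow> dist (dv (du h) q) (dv (du h) p) < e"
    using Ck_on_2D(4)[OF h] S e unfolding continuous_on_iff by metis
  obtain d2 where d2: "d2 > 0" "\<And>q. q \<in> S \<Longrightarrow> dist q p < d2 \<Longrightarrow> dist (du (dv h) q) (du (dv h) p) < e"
    using Ck_on_2D(5)[OF h] S e unfolding continuous_on_iff by metis
  define d where "d = min d0 (min d1 d2)"
  \<comment> \<open>Points of the square with corner \<open>p\<close> and side \<open>s\<close> are
    at distance at most 2 s < d from \<open>p\<close>.\<close>
  define s where "s = d / 3"
  have s: "s > 0" using d0 d1 d2 by (simp add: s_def d_def)
  have near: "dist (\<xi>, \<eta>) p < d" if "x \<le> \<xi>" "\<xi> \<le> x + s" "y \<le> \<eta>" "\<eta> \<le> y + s" for \<xi> \<eta>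
  proof -
    have "dist (\<xi>, \<eta>) p \<le> \<bar>\<xi> - x\<bar> + \<bar>\<eta> - y\<bar>"
      unfolding p dist_Pair_Pair dist_real_def by (metis sqrt_sum_squares_le_sum_abs power2_abs)
    also have "\<dots> < d" using that s by (simp add: s_def)
    finally show ?thesis .
  qed
  have inS: "(\<xi>, \<eta>) \<in> S" if "x \<le> \<xi>" "\<xi> \<le> x + s" "y \<le> \<eta>" "\<eta> \<le> y + s" for \<xi> \<eta>
    using near[OF that] d0(2) by (auto simp: d_def dist_commute)
  have Du: "DERIV (\<lambda>t. k (t, \<eta>)) \<xi> :> du k (\<xi>, \<eta>)"
    and Dv: "DERIV (\<lambda>t. k (\<xi>, t)) \<eta> :> dv k (\<xi>, \<eta>)"
    if "k differentiable_on S" "x \<le> \<xi>" "\<xi> \<le> x + s" "y \<le> \<eta>" "\<eta> \<le> y + s"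
    for \<xi> \<eta> and k :: "real \<times> real \<Rightarrow> real"
    using has_vector_derivative_du[OF that(1) S(1) inS[OF that(2-5)]]
      has_vector_derivative_dv[OF that(1) S(1) inS[OF that(2-5)]]
    by (simp_all add: has_real_derivative_iff_has_vector_derivative)
  define \<Delta> where "\<Delta> = h (x + s, y + s) - h (x + s, y) - (h (x, y + s) - h (x, y))"
  have "\<exists>\<xi>. x < \<xi> \<and> \<xi> < x + s \<and> \<Delta> = (x + s - x) * (du h (\<xi>, y + s) - du h (\<xi>, y))"
    unfolding \<Delta>_def using s
    by (intro MVT2[where f = "\<lambda>t. h (t, y + s) - h (t, y)"] derivative_intros Du Ck_on_2D(1)[OF h]) auto
  then obtain \<xi> where \<xi>: "x < \<xi>" "\<xi> < x + s" "\<Delta> = s * (du h (\<xi>, y + s) - du h (\<xi>, y))"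
    by auto
  have "\<exists>\<eta>. y < \<eta> \<and> \<eta> < y + s \<and>
      du h (\<xi>, y + s) - du h (\<xi>, y) = (y + s - y) * dv (du h) (\<xi>, \<eta>)"
    using s \<xi> by (intro MVT2 Dv Ck_on_2D(2)[OF h]) auto
  then obtain \<eta> where \<eta>: "y < \<eta>" "\<eta> < y + s" "\<Delta> = s * s * dv (du h) (\<xi>, \<eta>)"
    using \<xi> by auto
  \<comment> \<open>The four terms of \<open>\<Delta>\<close> are regrouped so that the mean value
    theorem applies in the opposite order of the variables.\<close>
  have "\<exists>\<eta>. y < \<eta> \<and> \<eta> < y + s \<and> h (x + s, y + s) - h (x, y + s) - (h (x + s, y) - h (x, y))
      = (y + s - y) * (dv h (x + s, \<eta>) - dv h (x, \<eta>))"
    using s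
    by (intro MVT2[where f = "\<lambda>t. h (x + s, t) - h (x, t)"] derivative_intros Dv Ck_on_2D(1)[OF h]) auto
  then obtain \<eta>' where \<eta>': "y < \<eta>'" "\<eta>' < y + s" "\<Delta> = s * (dv h (x + s, \<eta>') - dv h (x, \<eta>'))"
    unfolding \<Delta>_def by auto
  have "\<exists>\<xi>. x < \<xi> \<and> \<xi> < x + s \<and>
      dv h (x + s, \<eta>') - dv h (x, \<eta>') = (x + s - x) * du (dv h) (\<xi>, \<eta>')"
    using s \<eta>' by (intro MVT2 Du Ck_on_2D(3)[OF h]) auto
  then obtain \<xi>' where \<xi>': "x < \<xi>'" "\<xi>' < x + s" "\<Delta> = s * s * du (dv h) (\<xi>', \<eta>')"
    using \<eta>' by auto
  have "dv (du h) (\<xi>, \<eta>) = du (dv h) (\<xi>', \<eta>')"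
    using \<eta>(3) \<xi>'(3) s by simp
  moreover have "dist (dv (du h) (\<xi>, \<eta>)) (dv (du h) p) < e"
    using near[of \<xi> \<eta>] inS[of \<xi> \<eta>] \<xi> \<eta> by (intro d1(2)) (auto simp: d_def)
  moreover have "dist (du (dv h) (\<xi>', \<eta>')) (du (dv h) p) < e"
    using near[of \<xi>' \<eta>'] inS[of \<xi>' \<eta>'] \<xi>' \<eta>' by (intro d2(2)) (auto simp: d_def)
  ultimately have "dist (dv (du h) p) (du (dv h) p) < e + e"
    using dist_triangle3[of "dv (du h) p" "du (dv h) p" "dv (du h) (\<xi>, \<eta>)"] by simp
  then show False
    by (simp add: e_def dist_real_def)
qed

text \<open>Pairing with an arbitrary fixed vector commutes with both derivatives and reduces the
  claim to real functions.\<close>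

lemma mixed_partials:
  fixes h :: "real \<times> real \<Rightarrow> 'a::real_inner"
  assumes "Ck_on 2 S h" "open S" "p \<in> S"
  shows "dv (du h) p = du (dv h) p"
proof (rule vector_eq_rdot[THEN iffD1], rule allI)
  fix b :: 'a
  note T = bounded_linear_inner_left[of b]
  have "dv (du (\<lambda>q. h q \<bullet> b)) p = dv (\<lambda>q. du h q \<bullet> b) p"
    by (intro dv_cong[OF assms(2,3)] du_linear[OF T Ck_on_2D(1)[OF assms(1)] assms(2)])
  moreover have "du (dv (\<lambda>q. h q \<bullet> b)) p = du (\<lambda>q. dv h q \<bullet> b) p"
    by (intro du_cong[OF assms(2,3)] dv_linear[OF T Ck_on_2D(1)[OF assms(1)] assms(2)])
  ultimately show "dv (du h) p \<bullet> b = du (dv h) p \<bullet> b"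
    using mixed_partials_real[OF Ck_on_linear[OF T assms(2,1)] assms(2,3)]
      dv_linear[OF T Ck_on_2D(2)[OF assms(1)] assms(2,3)]
      du_linear[OF T Ck_on_2D(3)[OF assms(1)] assms(2,3)]
    by simp
qed


section \<open>Weingarten functions of the parallel surface\<close>

lemma sgn_connected:
  fixes h :: "'a::topological_space \<Rightarrow> real"
  assumes "connected S" "continuous_on S h" "\<And>x. x \<in> S \<Longrightarrow> h x \<noteq> 0" "x \<in> S" "y \<in> S"
  shows "sgn (h x) = sgn (h y)"
proof -
  have "is_interval (h ` S)"
    using assms by (simp add: connected_continuous_image is_interval_connected_1)
  moreover have "0 \<notin> h ` S"
    using assms(3) by force
  ultimately have "\<not> (h x < 0 \<and> 0 < h y)" "\<not> (h y < 0 \<and> 0 < h x)"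
    using mem_is_interval_1_I[of "h ` S" "h x" "h y" 0] mem_is_interval_1_I[of "h ` S" "h y" "h x" 0]
      assms(4,5) by auto
  then show ?thesis
    using assms(3)[OF assms(4)] assms(3)[OF assms(5)] by (auto simp: sgn_if)
qed

text \<open>Nonempty interior rules out a one-point interval, and a connected set with more than one
  point has no isolated points. Derivatives relative to \<open>I\<close> are thereby unique,
  endpoints included.\<close>

lemma islimpt_interval:
  fixes I :: "real set"
  assumes "is_interval I" "interior I \<noteq> {}" "x \<in> I"
  shows "x islimpt I"
proof (rule connected_imp_perfect)
  show "I \<noteq> {c}" for c
    using assms(2) by auto
qed (use assms is_interval_connected_1 in auto)

lemma has_real_derivative_D1:
  assumes "h differentiable_on I" "x \<in> I"
  shows "(h has_real_derivative D1 I h x) (at x within I)"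
  using assms unfolding D1_def
  by (simp add: differentiable_on_def has_real_derivative_iff_has_vector_derivative vector_derivative_works)

lemma D1_eqI:
  assumes "x islimpt I" "(h has_real_derivative d) (at x within I)"
  shows "D1 I h x = d"
  using assms unfolding D1_def
  by (intro vector_derivative_within)
    (auto simp: trivial_limit_within has_real_derivative_iff_has_vector_derivative)

lemma has_real_derivative_transform:
  assumes "x \<in> S" "\<And>y. y \<in> S \<Longrightarrow> h y = k y" "(k has_real_derivative d) (at x within S)"
  shows "(h has_real_derivative d) (at x within S)"
  using has_derivative_transform[OF assms(1,2)] assms(3) by (simp only: has_field_derivative_def)

lemma C2_funD:
  assumes "C2_fun I h"
  shows "h differentiable_on I" "D1 I h differentiable_on I" "continuous_on I (D1 I (D1 I h))"
    "continuous_on I h" "continuous_on I (D1 I h)"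
  using assms by (auto simp: C2_fun_def differentiable_imp_continuous_on)

text \<open>The component is relatively open in \<open>I\<close>: close to \<open>x\<close> the
  function differs from h(x) by less than |h(x)|, hence stays nonzero, and a ball meets the interval
  in a convex set.\<close>

lemma component_contains_ball:
  fixes h :: "real \<Rightarrow> real"
  assumes "is_interval I" "continuous_on I h"
    and "x \<in> connected_component_set {x \<in> I. h x \<noteq> 0} x0"
  obtains d where "d > 0" "I \<inter> ball x d \<subseteq> connected_component_set {x \<in> I. h x \<noteq> 0} x0"
proof -
  have x: "x \<in> I" "h x \<noteq> 0"
    using assms(3) connected_component_subset by blast+
  obtain d where d: "d > 0" "\<And>y. y \<in> I \<Longrightarrow> dist y x < d \<Longrightarrow> dist (h y) (h x) < \<bar>h x\<bar>"
    using assms(2) x unfolding continuous_on_iff by (metis zero_less_abs_iff)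
  have "I \<inter> ball x d \<subseteq> connected_component_set {x \<in> I. h x \<noteq> 0} x"
  proof (rule connected_component_maximal)
    show "connected (I \<inter> ball x d)"
      using assms(1) by (simp add: is_interval_convex_1 convex_Int convex_connected)
    show "I \<inter> ball x d \<subseteq> {x \<in> I. h x \<noteq> 0}"
      using d(2) by (fastforce simp: dist_real_def)
  qed (use x d in auto)
  then show ?thesis
    using that d(1) connected_component_eq[OF assms(3)] by simp
qed

section \<open>One-variable theory of the transformed Weingarten functions\<close>

locale weingarten_parallel =
  fixes I :: "real set" and f g :: "real \<Rightarrow> real" and a x0 :: real
  assumes weingarten: "weingarten_functions I f g"
    and x0: "x0 \<in> I" "(1 - a * f x0) * (1 - a * g x0) \<noteq> 0"
begin

definition J where "J = par_interval a I f g x0"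
definition \<epsilon> where "\<epsilon> = sgn ((1 - a * f x0) * (1 - a * g x0))"

lemma I: "is_interval I" "interior I \<noteq> {}"
  and C2_f: "C2_fun I f" and C2_g: "C2_fun I g"
  and f_ne_g: "x \<in> I \<Longrightarrow> f x \<noteq> g x"
  and D1_ne_0: "x \<in> I \<Longrightarrow> D1 I f x \<noteq> 0" "x \<in> I \<Longrightarrow> D1 I g x \<noteq> 0"
  using weingarten by (auto simp: weingarten_functions_def)

lemma continuous_singular: "continuous_on I (\<lambda>x. (1 - a * f x) * (1 - a * g x))"
  by (intro continuous_intros C2_funD C2_f C2_g)

lemma J_subset: "x \<in> J \<Longrightarrow> x \<in> I"
  and nonsingular: "x \<in> J \<Longrightarrow> 1 - a * f x \<noteq> 0" "x \<in> J \<Longrightarrow> 1 - a * g x \<noteq> 0"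
  using connected_component_subset[of "{x \<in> I. (1 - a * f x) * (1 - a * g x) \<noteq> 0}" x0]
  unfolding J_def par_interval_def by auto

lemma x0_in_J: "x0 \<in> J"
  using x0 by (simp add: J_def par_interval_def)

lemma interval_J: "is_interval J"
  by (simp add: J_def par_interval_def is_interval_connected_1)

lemma sgn_eq: "x \<in> J \<Longrightarrow> sgn ((1 - a * f x) * (1 - a * g x)) = \<epsilon>"
  unfolding \<epsilon>_def
  using interval_J J_subset nonsingular x0_in_J
  by (intro sgn_connected[of J] continuous_on_subset[OF continuous_singular])
    (auto simp: is_interval_connected_1)

lemma \<epsilon>_ne_0 [simp]: "\<epsilon> \<noteq> 0" and \<epsilon>_square [simp]: "\<epsilon> * \<epsilon> = 1" "\<epsilon> * (\<epsilon> * r) = r"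
  using x0(2) by (auto simp: \<epsilon>_def sgn_if)

lemma par_fun_eq:
  assumes "x \<in> J"
  shows "par_fun a f g x = \<epsilon> * f x / (1 - a * f x)" "par_fun a g f x = \<epsilon> * g x / (1 - a * g x)"
  using sgn_eq[OF assms] by (simp_all add: par_fun_def mult.commute)

text \<open>\<open>J\<close> and \<open>\<epsilon>\<close> depend only on the product (1 - a f)(1 -
  a g), which is symmetric, so every fact about \<open>par_fun a f g\<close> transfers to
  \<open>par_fun a g f\<close> with the same interval and sign.\<close>

lemma swap: "weingarten_parallel I g f a x0"
  using weingarten x0 by unfold_locales (auto simp: weingarten_functions_def mult.commute)

lemma J_swap: "weingarten_parallel.J I g f a x0 = J"
  using weingarten_parallel.J_def[OF swap] by (simp add: J_def par_interval_def mult.commute)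

lemma \<epsilon>_swap: "weingarten_parallel.\<epsilon> g f a x0 = \<epsilon>"
  using weingarten_parallel.\<epsilon>_def[OF swap] by (simp add: \<epsilon>_def mult.commute)

lemma ball_in_J:
  assumes "x \<in> J"
  obtains d where "d > 0" "I \<inter> ball x d \<subseteq> J"
  using component_contains_ball[OF I(1) continuous_singular] assms
  unfolding J_def par_interval_def by blast

text \<open>Since \<open>J\<close> contains a relative neighbourhood of each of its points,
  derivatives relative to \<open>I\<close> and to \<open>J\<close> coincide, also at an endpoint of
  \<open>I\<close> belonging to \<open>J\<close>.\<close>

lemma at_within_J: "x \<in> J \<Longrightarrow> at x within J = at x within I"
proof -
  assume x: "x \<in> J"
  obtain d where d: "d > 0" "I \<inter> ball x d \<subseteq> J" using ball_in_J[OF x] .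
  show ?thesis
    using d J_subset by (intro at_within_nhd[of x "ball x d"]) auto
qed

lemma islimpt_J: "x \<in> J \<Longrightarrow> x islimpt J"
  using islimpt_interval[OF I, of x] at_within_J[of x] J_subset[of x]
    trivial_limit_within[of x I] trivial_limit_within[of x J]
  by simp

lemma segment_in_J: "\<lbrakk>x \<in> J; y \<in> J; min x y \<le> t; t \<le> max x y\<rbrakk> \<Longrightarrow> t \<in> J"
  using mem_is_interval_1_I[OF interval_J, of x y t] mem_is_interval_1_I[OF interval_J, of y x t]
  by (cases "x \<le> y") simp_all

text \<open>As a limit point of \<open>J\<close>, \<open>x0\<close> has a companion in
  \<open>J\<close>, and the open segment between them is interior.\<close>

lemma interior_J: "interior J \<noteq> {}"
proof -
  have "x0 \<in> J" "x0 islimpt J" using x0_in_J islimpt_J by auto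
  then obtain y where y: "y \<in> J" "y \<noteq> x0"
    using islimptE[of x0 J UNIV] by auto
  have "{min x0 y<..<max x0 y} \<subseteq> J"
    by (intro subsetI segment_in_J[OF x0_in_J y(1)]) auto
  then have "{min x0 y<..<max x0 y} \<subseteq> interior J"
    by (rule interior_maximal) simp
  moreover have "{min x0 y<..<max x0 y} \<noteq> {}"
    using y by auto
  ultimately show ?thesis by blast
qed

lemma DERIV_f:
  assumes "x \<in> J"
  shows "(f has_real_derivative D1 I f x) (at x within J)"
    "(D1 I f has_real_derivative D1 I (D1 I f) x) (at x within J)"
  using has_real_derivative_D1[OF _ J_subset[OF assms]] C2_funD[OF C2_f]
  by (simp_all add: at_within_J[OF assms])

text \<open>In the quotient rule f' (1 - a f) + a f f' collapses to f'.\<close>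

lemma par_fun_derivative:
  assumes "x \<in> J"
  shows "(par_fun a f g has_real_derivative \<epsilon> * D1 I f x / (1 - a * f x)\<^sup>2) (at x within J)"
proof (rule has_real_derivative_transform[OF assms])
  show "((\<lambda>x. \<epsilon> * f x / (1 - a * f x)) has_real_derivative \<epsilon> * D1 I f x / (1 - a * f x)\<^sup>2) (at x within J)"
    using nonsingular(1)[OF assms]
    by (auto intro!: derivative_eq_intros DERIV_f[OF assms] simp: field_simps power2_eq_square)
qed (rule par_fun_eq)

lemma D1_par_fun: "x \<in> J \<Longrightarrow> D1 J (par_fun a f g) x = \<epsilon> * D1 I f x / (1 - a * f x)\<^sup>2"
  by (intro D1_eqI islimpt_J par_fun_derivative)

lemma D1_par_fun_derivative:
  assumes "x \<in> J"
  shows "(D1 J (par_fun a f g) has_real_derivative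
    \<epsilon> * (D1 I (D1 I f) x / (1 - a * f x)\<^sup>2 + 2 * a * (D1 I f x)\<^sup>2 / (1 - a * f x) ^ 3)) (at x within J)"
proof (rule has_real_derivative_transform[OF assms D1_par_fun])
  have u: "((\<lambda>x. (1 - a * f x)\<^sup>2) has_real_derivative 2 * (1 - a * f x) * - (a * D1 I f x)) (at x within J)"
    by (auto intro!: derivative_eq_intros DERIV_f[OF assms])
  have eq: "(\<epsilon> * d2 * r\<^sup>2 - \<epsilon> * d1 * (2 * r * - (a * d1))) / (r\<^sup>2 * r\<^sup>2)
      = \<epsilon> * (d2 / r\<^sup>2 + 2 * a * d1\<^sup>2 / r ^ 3)" if "r \<noteq> 0" for r d1 d2 :: real
    using that by (simp add: field_simps power2_eq_square power3_eq_cube)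
  show "((\<lambda>x. \<epsilon> * D1 I f x / (1 - a * f x)\<^sup>2) has_real_derivative
    \<epsilon> * (D1 I (D1 I f) x / (1 - a * f x)\<^sup>2 + 2 * a * (D1 I f x)\<^sup>2 / (1 - a * f x) ^ 3)) (at x within J)"
    by (rule DERIV_cong[OF DERIV_divide[OF DERIV_cmult[OF DERIV_f(2)[OF assms]] u] eq])
      (use nonsingular(1)[OF assms] in auto)
qed

lemma D1_D1_par_fun: "x \<in> J \<Longrightarrow> D1 J (D1 J (par_fun a f g)) x =
    \<epsilon> * (D1 I (D1 I f) x / (1 - a * f x)\<^sup>2 + 2 * a * (D1 I f x)\<^sup>2 / (1 - a * f x) ^ 3)"
  by (intro D1_eqI islimpt_J D1_par_fun_derivative)

lemma continuous_on_J: "continuous_on I h \<Longrightarrow> continuous_on J h"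
  using J_subset continuous_on_subset by blast

lemma C2_par_fun: "C2_fun J (par_fun a f g)"
proof -
  have "continuous_on J (\<lambda>x. \<epsilon> * (D1 I (D1 I f) x / (1 - a * f x)\<^sup>2
      + 2 * a * (D1 I f x)\<^sup>2 / (1 - a * f x) ^ 3))"
    using nonsingular by (intro continuous_intros continuous_on_J[OF C2_funD(3)[OF C2_f]]
        continuous_on_J[OF C2_funD(4)[OF C2_f]] continuous_on_J[OF C2_funD(5)[OF C2_f]]) auto
  then have "continuous_on J (D1 J (D1 J (par_fun a f g)))"
    by (simp add: D1_D1_par_fun cong: continuous_on_cong)
  then show ?thesis
    unfolding C2_fun_def differentiable_on_def real_differentiable_def
    using par_fun_derivative D1_par_fun_derivative
    by blast
qed

lemma par_fun_diff:
  assumes "x \<in> J"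
  shows "par_fun a f g x - par_fun a g f x = \<epsilon> * (f x - g x) / ((1 - a * f x) * (1 - a * g x))"
  using nonsingular[OF assms] by (simp add: par_fun_eq[OF assms] field_simps)

lemma weingarten_par_fun:
  "weingarten_functions J (par_fun a f g) (par_fun a g f)"
  using interval_J interior_J C2_par_fun weingarten_parallel.C2_par_fun[OF swap, unfolded J_swap]
    D1_par_fun weingarten_parallel.D1_par_fun[OF swap, unfolded J_swap \<epsilon>_swap]
    par_fun_diff nonsingular f_ne_g D1_ne_0 J_subset
  by (simp add: weingarten_functions_def)

lemma wint_par_fun:
  assumes "x \<in> J" "y \<in> J"
  shows "wint J (par_fun a f g) (par_fun a g f) x y =
    wint I f g x y + ln \<bar>1 - a * f x\<bar> - ln \<bar>1 - a * f y\<bar>"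
proof -
  let ?S = "{min x y..max x y}"
  define q where "q = (\<lambda>t. D1 I f t / (f t - g t))"
  \<comment> \<open>This is ln |1 - a f|, written through the square so that its derivative needs no
    case distinction on the sign.\<close>
  define L where "L = (\<lambda>t. ln ((1 - a * f t)\<^sup>2) / 2)"
  have S: "?S \<subseteq> J" using segment_in_J[OF assms] by auto
  have q: "continuous_on ?S q"
    unfolding q_def using S J_subset f_ne_g
    by (intro continuous_intros continuous_on_subset[OF C2_funD(4)[OF C2_f]]
        continuous_on_subset[OF C2_funD(4)[OF C2_g]] continuous_on_subset[OF C2_funD(5)[OF C2_f]]) auto
  obtain Q where Q: "\<And>t. t \<in> ?S \<Longrightarrow> (Q has_vector_derivative q t) (at t within ?S)"
    using antiderivative_continuous[OF q] by blast
  have q': "D1 J (par_fun a f g) t / (par_fun a f g t - par_fun a g f t)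
      = q t + a * D1 I f t / (1 - a * f t)" if "t \<in> ?S" for t
  proof -
    have t: "t \<in> J" "f t \<noteq> g t" using that S f_ne_g J_subset by auto
    \<comment> \<open>With r = 1 - a f and k = f - g, the factor 1 - a g is r + a k; the sign
      cancels and (r + a k) / (r k) = 1 / k + a / r.\<close>
    have "\<epsilon> * d / r\<^sup>2 / (\<epsilon> * k / (r * (r + a * k))) = d / k + a * d / r"
      if "r \<noteq> 0" "k \<noteq> 0" "r + a * k \<noteq> 0" for r k d
      using that by (simp add: field_simps power2_eq_square)
    from this[of "1 - a * f t" "f t - g t" "D1 I f t"] show ?thesis
      using nonsingular[OF t(1)] t(2)
      unfolding par_fun_diff[OF t(1)] D1_par_fun[OF t(1)] q_def
      by (simp add: algebra_simps)
  qed
  have L: "(L has_vector_derivative - (a * D1 I f t / (1 - a * f t))) (at t within ?S)"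
    if "t \<in> ?S" for t
  proof -
    have t: "t \<in> J" using that S by auto
    have u: "((\<lambda>t. (1 - a * f t)\<^sup>2) has_real_derivative 2 * (1 - a * f t) * - (a * D1 I f t)) (at t within ?S)"
      by (auto intro!: derivative_eq_intros DERIV_subset[OF DERIV_f(1)[OF t] S])
    have eq: "inverse (r\<^sup>2) * (2 * r * - d) / 2 = - (d / r)" if "r \<noteq> 0" for r d :: real
      using that by (simp add: field_simps power2_eq_square)
    have "(L has_real_derivative - (a * D1 I f t / (1 - a * f t))) (at t within ?S)"
      unfolding L_def
      by (rule DERIV_cong[OF DERIV_cdivide[OF DERIV_chain2[OF DERIV_ln u]] eq])
        (use nonsingular(1)[OF t] in auto)
    then show ?thesis
      by (simp only: has_real_derivative_iff_has_vector_derivative)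
  qed
  have "wint J (par_fun a f g) (par_fun a g f) x y = (Q y - L y) - (Q x - L x)"
    unfolding wint_def
  proof (rule interval_integral_FTC_finite)
    show "continuous_on ?S (\<lambda>t. D1 J (par_fun a f g) t / (par_fun a f g t - par_fun a g f t))"
    proof (rule continuous_on_eq[OF _ q'[symmetric]])
      show "continuous_on ?S (\<lambda>t. q t + a * D1 I f t / (1 - a * f t))"
        using S J_subset nonsingular
        by (intro continuous_intros q continuous_on_subset[OF C2_funD(4)[OF C2_f]]
            continuous_on_subset[OF C2_funD(5)[OF C2_f]]) auto
    qed
    show "((\<lambda>t. Q t - L t) has_vector_derivative
        D1 J (par_fun a f g) t / (par_fun a f g t - par_fun a g f t)) (at t within ?S)"
      if "min x y \<le> t" "t \<le> max x y" for t
    proof -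
      have t: "t \<in> ?S" using that by simp
      show ?thesis
        unfolding q'[OF t] using has_vector_derivative_diff[OF Q[OF t] L[OF t]]
        by (simp only: diff_minus_eq_add)
    qed
  qed
  moreover have "wint I f g x y = Q y - Q x"
    unfolding wint_def q_def[symmetric]
    using q Q by (intro interval_integral_FTC_finite) (auto simp: q_def)
  moreover have "L t = ln \<bar>1 - a * f t\<bar>" if "t \<in> J" for t
  proof -
    have "ln (\<bar>1 - a * f t\<bar>\<^sup>2) = 2 * ln \<bar>1 - a * f t\<bar>"
      using nonsingular(1)[OF that] by (subst ln_realpow) auto
    then show ?thesis by (simp add: L_def)
  qed
  ultimately show ?thesis
    using assms by simp
qed

lemma exp_wint_par_fun:
  assumes "x \<in> J" "y \<in> J"
  shows "exp (wint J (par_fun a f g) (par_fun a g f) x y) =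
    exp (wint I f g x y) * \<bar>1 - a * f x\<bar> / \<bar>1 - a * f y\<bar>"
  using nonsingular(1) assms by (simp add: wint_par_fun exp_add exp_diff)

lemma exp_2_wint_par_fun:
  assumes "x \<in> J" "y \<in> J"
  shows "exp (2 * wint J (par_fun a f g) (par_fun a g f) x y) =
    exp (2 * wint I f g x y) * (1 - a * f x)\<^sup>2 / (1 - a * f y)\<^sup>2"
  by (simp add: exp_double exp_wint_par_fun[OF assms] power_mult_distrib power_divide)

text \<open>The second derivative brings the extra term 2 a f'^2 / (1 - a f)^3. Replacing 1 - a g by
  (1 - a f) + a (f - g) splits the quotient into the rescaled original term and exactly this extra
  term, so the two extras cancel.\<close>

lemma par_fun_bracket:
  assumes "x \<in> J"
  shows "D1 J (D1 J (par_fun a f g)) x - 2 * (D1 J (par_fun a f g) x)\<^sup>2 / (par_fun a f g x - par_fun a g f x)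
    = \<epsilon> / (1 - a * f x)\<^sup>2 * (D1 I (D1 I f) x - 2 * (D1 I f x)\<^sup>2 / (f x - g x))"
proof -
  define \<alpha> \<beta> where "\<alpha> = 1 - a * f x" and "\<beta> = 1 - a * g x"
  have ne: "\<alpha> \<noteq> 0" "\<beta> \<noteq> 0" "f x - g x \<noteq> 0"
    using nonsingular[OF assms] f_ne_g J_subset[OF assms] by (auto simp: \<alpha>_def \<beta>_def)
  have e: "\<beta> = \<alpha> + a * (f x - g x)" by (simp add: \<alpha>_def \<beta>_def algebra_simps)
  have "2 * (\<epsilon> * D1 I f x / \<alpha>\<^sup>2)\<^sup>2 / (\<epsilon> * (f x - g x) / (\<alpha> * \<beta>))
      = \<epsilon> * (2 * (D1 I f x)\<^sup>2 * \<beta> / (\<alpha> ^ 3 * (f x - g x)))"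
    using ne by (simp add: divide_simps power2_eq_square power3_eq_cube)
  also have "\<dots> = \<epsilon> * (2 * (D1 I f x)\<^sup>2 / (\<alpha>\<^sup>2 * (f x - g x)) + 2 * a * (D1 I f x)\<^sup>2 / \<alpha> ^ 3)"
    unfolding e using ne by (simp add: field_simps power2_eq_square power3_eq_cube)
  finally show ?thesis
    unfolding D1_D1_par_fun[OF assms] D1_par_fun[OF assms] par_fun_diff[OF assms]
      \<alpha>_def[symmetric] \<beta>_def[symmetric]
    by (simp add: algebra_simps)
qed

end

text \<open>All coefficients depend on the unknown only through its value x at the point. Five
  coefficient identities with one factor \<open>c x\<close> therefore suffice, whatever values the
  derivatives of \<open>\<phi>\<close> take.\<close>

lemma same_pde_natural_pde_expr:
  assumes c: "continuous_on J c" "\<And>x. x \<in> J \<Longrightarrow> c x \<noteq> 0"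
    and u: "\<And>x. x \<in> J \<Longrightarrow> A'\<^sup>2 * exp (2 * wint J F G y x) * D1 J G x
        = c x * (A\<^sup>2 * exp (2 * wint I f g y x) * D1 I g x)"
      "\<And>x. x \<in> J \<Longrightarrow> A'\<^sup>2 * exp (2 * wint J F G y x) *
          (D1 J (D1 J G) x - 2 * (D1 J G x)\<^sup>2 / (G x - F x))
        = c x * (A\<^sup>2 * exp (2 * wint I f g y x) *
          (D1 I (D1 I g) x - 2 * (D1 I g x)\<^sup>2 / (g x - f x)))"
    and v: "\<And>x. x \<in> J \<Longrightarrow> B'\<^sup>2 * exp (2 * wint J G F y x) * D1 J F x
        = c x * (B\<^sup>2 * exp (2 * wint I g f y x) * D1 I f x)"
      "\<And>x. x \<in> J \<Longrightarrow> B'\<^sup>2 * exp (2 * wint J G F y x) *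
          (D1 J (D1 J F) x - 2 * (D1 J F x)\<^sup>2 / (F x - G x))
        = c x * (B\<^sup>2 * exp (2 * wint I g f y x) *
          (D1 I (D1 I f) x - 2 * (D1 I f x)\<^sup>2 / (f x - g x)))"
    and r: "\<And>x. x \<in> J \<Longrightarrow> F x * G x * (F x - G x) = c x * (f x * g x * (f x - g x))"
  shows "same_pde J (natural_pde_expr I f g y A B) (natural_pde_expr J F G y A' B')"
  unfolding same_pde_def
proof (intro exI conjI ballI allI impI)
  fix U :: "(real \<times> real) set" and \<phi> p
  assume "\<phi> ` U \<subseteq> J" "p \<in> U"
  then have x: "\<phi> p \<in> J" by blast
  have combine: "M * (s * k + t * m) = c * (N * (s' * k + t' * m))"
    if "M * s = c * (N * s')" "M * t = c * (N * t')" for M N s s' t t' k m c :: real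
    using that by algebra
  show "natural_pde_expr J F G y A' B' \<phi> p = c (\<phi> p) * natural_pde_expr I f g y A B \<phi> p"
    unfolding natural_pde_expr_def Let_def
    unfolding combine[OF u[OF x]] combine[OF v[OF x]] r[OF x]
    by (simp add: algebra_simps)
qed (use c in auto)

text \<open>For the u-derivatives, the exponential weight supplies 1 / (1 - a f)^2 and the
  derivatives of \<open>par_fun a g f\<close> supply \<epsilon> / (1 - a g)^2; the hypothesis on
  \<open>A'\<close> absorbs what the lower limit \<open>y\<close> leaves over.\<close>

lemma (in weingarten_parallel) pde_coefficients:
  assumes y: "y \<in> J" and x: "x \<in> J" and A: "A'\<^sup>2 = A\<^sup>2 / (1 - a * f y)\<^sup>2"
  shows "A'\<^sup>2 * exp (2 * wint J (par_fun a f g) (par_fun a g f) y x) * D1 J (par_fun a g f) x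
      = \<epsilon> / ((1 - a * f x) * (1 - a * g x))\<^sup>2 * (A\<^sup>2 * exp (2 * wint I f g y x) * D1 I g x)"
    and "A'\<^sup>2 * exp (2 * wint J (par_fun a f g) (par_fun a g f) y x) *
      (D1 J (D1 J (par_fun a g f)) x
        - 2 * (D1 J (par_fun a g f) x)\<^sup>2 / (par_fun a g f x - par_fun a f g x))
      = \<epsilon> / ((1 - a * f x) * (1 - a * g x))\<^sup>2 * (A\<^sup>2 * exp (2 * wint I f g y x) *
        (D1 I (D1 I g) x - 2 * (D1 I g x)\<^sup>2 / (g x - f x)))"
proof -
  interpret swapped: weingarten_parallel I g f a x0 by (rule swap)
  have exp: "A'\<^sup>2 * exp (2 * wint J (par_fun a f g) (par_fun a g f) y x)
      = A\<^sup>2 * exp (2 * wint I f g y x) / (1 - a * f x)\<^sup>2"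
    using nonsingular(1)[OF y] by (simp add: A exp_2_wint_par_fun[OF y x])
  show "A'\<^sup>2 * exp (2 * wint J (par_fun a f g) (par_fun a g f) y x) * D1 J (par_fun a g f) x
      = \<epsilon> / ((1 - a * f x) * (1 - a * g x))\<^sup>2 * (A\<^sup>2 * exp (2 * wint I f g y x) * D1 I g x)"
    using swapped.D1_par_fun[unfolded J_swap \<epsilon>_swap, OF x]
    by (simp add: exp power_mult_distrib mult_ac)
  show "A'\<^sup>2 * exp (2 * wint J (par_fun a f g) (par_fun a g f) y x) *
      (D1 J (D1 J (par_fun a g f)) x
        - 2 * (D1 J (par_fun a g f) x)\<^sup>2 / (par_fun a g f x - par_fun a f g x))
      = \<epsilon> / ((1 - a * f x) * (1 - a * g x))\<^sup>2 * (A\<^sup>2 * exp (2 * wint I f g y x) *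
        (D1 I (D1 I g) x - 2 * (D1 I g x)\<^sup>2 / (g x - f x)))"
    unfolding swapped.par_fun_bracket[unfolded J_swap \<epsilon>_swap, OF x] exp
    by (simp add: power_mult_distrib mult_ac)
qed

lemma (in weingarten_parallel) same_pde_par_fun:
  assumes A: "A'\<^sup>2 = A\<^sup>2 / (1 - a * f x0)\<^sup>2" and B: "B'\<^sup>2 = B\<^sup>2 / (1 - a * g x0)\<^sup>2"
  shows "same_pde J (natural_pde_expr I f g x0 A B)
    (natural_pde_expr J (par_fun a f g) (par_fun a g f) x0 A' B')"
proof (rule same_pde_natural_pde_expr[where c = "\<lambda>x. \<epsilon> / ((1 - a * f x) * (1 - a * g x))\<^sup>2"])
  show "continuous_on J (\<lambda>x. \<epsilon> / ((1 - a * f x) * (1 - a * g x))\<^sup>2)"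
    using nonsingular
    by (intro continuous_intros continuous_on_J[OF C2_funD(4)[OF C2_f]]
        continuous_on_J[OF C2_funD(4)[OF C2_g]]) auto
  fix x assume x: "x \<in> J"
  show "\<epsilon> / ((1 - a * f x) * (1 - a * g x))\<^sup>2 \<noteq> 0"
    using nonsingular[OF x] by simp
  \<comment> \<open>Two transformed functions and their difference each contribute one \<epsilon>,
    and \<epsilon>^3 = \<epsilon>.\<close>
  show "par_fun a f g x * par_fun a g f x * (par_fun a f g x - par_fun a g f x)
      = \<epsilon> / ((1 - a * f x) * (1 - a * g x))\<^sup>2 * (f x * g x * (f x - g x))"
    unfolding par_fun_diff[OF x] unfolding par_fun_eq[OF x] by (simp add: power2_eq_square mult_ac)
\<comment> \<open>The v-derivatives are the u-derivatives with f and g exchanged; only the order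
  inside the product (1 - a f)(1 - a g) has to be adjusted.\<close>
qed (use pde_coefficients[OF x0_in_J _ A]
    weingarten_parallel.pde_coefficients[OF swap, unfolded J_swap \<epsilon>_swap, OF x0_in_J _ B]
    in \<open>simp_all only: mult.commute[of "1 - a * g _"]\<close>)


section \<open>Geometry of the parallel surface\<close>

text \<open>The form is indefinite, so non-nullity is assumed: pairing a linear relation with each
  of the three orthogonal vectors isolates one coefficient. They thus span the space, and a vector
  orthogonal to everything vanishes, as the coordinate axes show.\<close>

lemma independent_mink_orthogonal:
  assumes "mink x x \<noteq> 0" "mink y y \<noteq> 0" "mink w w \<noteq> 0"
    and "mink x y = 0" "mink x w = 0" "mink y w = 0"
    and "mink r x = 0" "mink r y = 0" "mink r w = 0"
  shows "r = 0"
proof -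
  interpret bounded_bilinear mink by (rule bounded_bilinear_mink)
  have [simp]: "mink y x = 0" "mink w x = 0" "mink w y = 0"
    using assms by (simp_all add: mink_commute)
  have ne: "x \<noteq> y" "x \<noteq> w" "y \<noteq> w"
    using assms by auto
  have "independent {x, y, w}"
  proof (rule ccontr)
    assume "\<not> independent {x, y, w}"
    then obtain c where c: "\<exists>v\<in>{x, y, w}. c v \<noteq> 0" "(\<Sum>v\<in>{x, y, w}. c v *\<^sub>R v) = 0"
      by (auto simp: real_vector.dependent_finite)
    then have s: "c x *\<^sub>R x + (c y *\<^sub>R y + c w *\<^sub>R w) = 0"
      using ne by simp
    have "c x = 0" "c y = 0" "c w = 0"
      using arg_cong[OF s, of "\<lambda>v. mink v x"] arg_cong[OF s, of "\<lambda>v. mink v y"]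
        arg_cong[OF s, of "\<lambda>v. mink v w"] assms
      by (simp_all add: add_left scaleR_left zero_left)
    then show False using c(1) by auto
  qed
  then have "span {x, y, w} = UNIV"
    using ne by (intro order_antisym subset_UNIV card_ge_dim_independent[of _ UNIV]) auto
  moreover have "mink r v = 0" if "v \<in> span {x, y, w}" for v
    using that
    by (induction rule: span_induct_alt) (use assms in \<open>auto simp: add_right scaleR_right zero_right\<close>)
  ultimately have r: "mink r v = 0" for v by simp
  show "r = 0"
    using r[of "axis 1 1"] r[of "axis 2 1"] r[of "axis 3 1"]
    by (simp add: mink_def vec_eq_iff forall_3 axis_def)
qed

section \<open>Rodrigues formulas and fundamental forms of the parallel surface\<close>

locale principal_surface =
  fixes D :: "(real \<times> real) set" and z l :: surf
  assumes timelike: "timelike_surface D z l" and principal: "principal_params D z l"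
begin

lemma D: "open D" "connected D"
  and z: "Ck_on 2 D z" and l: "Ck_on 2 D l"
  using timelike by (auto simp: timelike_surface_def)

lemma frame:
  assumes "p \<in> D"
  shows "mink (l p) (l p) = 1" "mink (l p) (du z p) = 0" "mink (l p) (dv z p) = 0"
    "mink (du z p) (l p) = 0" "mink (dv z p) (l p) = 0"
    "mink (du z p) (du z p) < 0" "mink (dv z p) (dv z p) > 0"
    "mink (du z p) (dv z p) = 0" "mink (dv z p) (du z p) = 0"
    "mink (l p) (dv (du z) p) = 0"
  using timelike principal assms
  by (auto simp: timelike_surface_def principal_params_def cE_def cG_def cF_def cM_def mink_commute)

text \<open>Obtained by differentiating <l, l> = 1 and <l, z_u> = <l, z_v> = 0. One of the relations
  produces \<open>du (dv z)\<close> whereas M = 0 concerns \<open>dv (du z)\<close>; this is where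
  the symmetry of mixed derivatives enters.\<close>

lemma l_derivatives:
  assumes p: "p \<in> D"
  shows "mink (du l p) (l p) = 0" "mink (dv l p) (l p) = 0"
    "mink (du l p) (du z p) = - cL z l p" "mink (dv l p) (dv z p) = - cN z l p"
    "mink (du l p) (dv z p) = 0" "mink (dv l p) (du z p) = 0"
proof -
  note zD = Ck_on_2D(1-3)[OF z] and lD = Ck_on_2D(1)[OF l]
  have "du (\<lambda>q. mink (l q) (l q)) p = 0" "dv (\<lambda>q. mink (l q) (l q)) p = 0"
    by (subst du_cong[OF D(1) p, of _ "\<lambda>q. 1"] dv_cong[OF D(1) p, of _ "\<lambda>q. 1"]; simp add: frame)+
  then show "mink (du l p) (l p) = 0" "mink (dv l p) (l p) = 0"
    by (simp_all add: du_mink[OF lD lD D(1) p] dv_mink[OF lD lD D(1) p] mink_commute)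
  have "du (\<lambda>q. mink (l q) (du z q)) p = 0" "dv (\<lambda>q. mink (l q) (du z q)) p = 0"
    "du (\<lambda>q. mink (l q) (dv z q)) p = 0" "dv (\<lambda>q. mink (l q) (dv z q)) p = 0"
    by (subst du_cong[OF D(1) p, of _ "\<lambda>q. 0"] dv_cong[OF D(1) p, of _ "\<lambda>q. 0"]; simp add: frame)+
  then show "mink (du l p) (du z p) = - cL z l p" "mink (dv l p) (dv z p) = - cN z l p"
    "mink (du l p) (dv z p) = 0" "mink (dv l p) (du z p) = 0"
    using frame(10)[OF p] mixed_partials[OF z D(1) p]
    by (simp_all add: du_mink[OF lD zD(2) D(1) p] dv_mink[OF lD zD(2) D(1) p]
        du_mink[OF lD zD(3) D(1) p] dv_mink[OF lD zD(3) D(1) p] cL_def cN_def)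
qed

text \<open>The vector l_u + \<nu>_1 z_u is orthogonal to l, z_u and z_v, since <l_u, z_u> = -L =
  -\<nu>_1 E; likewise for v.\<close>

lemma rodrigues:
  assumes p: "p \<in> D"
  shows "du l p = - curv1 z l p *\<^sub>R du z p" "dv l p = - curv2 z l p *\<^sub>R dv z p"
proof -
  have "mink (du z p) (du z p) \<noteq> 0" "mink (dv z p) (dv z p) \<noteq> 0"
    using frame(6,7)[OF p] by auto
  note F = this frame(1-5,8,9)[OF p] l_derivatives[OF p] mink_simps
  have "du l p + curv1 z l p *\<^sub>R du z p = 0"
    by (rule independent_mink_orthogonal[of "l p" "du z p" "dv z p"])
      (simp_all add: F curv1_def cE_def)
  moreover have "dv l p + curv2 z l p *\<^sub>R dv z p = 0"
    by (rule independent_mink_orthogonal[of "l p" "du z p" "dv z p"])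
      (simp_all add: F curv2_def cG_def)
  ultimately show "du l p = - curv1 z l p *\<^sub>R du z p" "dv l p = - curv2 z l p *\<^sub>R dv z p"
    by (simp_all add: eq_neg_iff_add_eq_0)
qed

text \<open>Differentiating <l, l_u> = 0 gives <l, l_uu> = -<l_u, l_u>, and similarly for the
  others. The Rodrigues formulas are then inserted only at first order, so the curvatures are never
  differentiated.\<close>

lemma l_second_derivatives:
  assumes p: "p \<in> D"
  shows "mink (l p) (du (du l) p) = - (curv1 z l p)\<^sup>2 * cE z p"
    "mink (l p) (dv (du l) p) = 0"
    "mink (l p) (dv (dv l) p) = - (curv2 z l p)\<^sup>2 * cG z p"
proof -
  note lD = Ck_on_2D(1-3)[OF l]
  have "du (\<lambda>q. mink (l q) (du l q)) p = 0" "dv (\<lambda>q. mink (l q) (du l q)) p = 0"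
    "dv (\<lambda>q. mink (l q) (dv l q)) p = 0"
    by (subst du_cong[OF D(1) p, of _ "\<lambda>q. 0"] dv_cong[OF D(1) p, of _ "\<lambda>q. 0"];
        simp add: mink_commute[of "l _"] l_derivatives)+
  then have "mink (l p) (du (du l) p) + mink (du l p) (du l p) = 0"
    "mink (l p) (dv (du l) p) + mink (dv l p) (du l p) = 0"
    "mink (l p) (dv (dv l) p) + mink (dv l p) (dv l p) = 0"
    by (simp_all add: du_mink[OF lD(1,2) D(1) p] dv_mink[OF lD(1,2) D(1) p] dv_mink[OF lD(1,3) D(1) p])
  then show "mink (l p) (du (du l) p) = - (curv1 z l p)\<^sup>2 * cE z p"
    "mink (l p) (dv (du l) p) = 0"
    "mink (l p) (dv (dv l) p) = - (curv2 z l p)\<^sup>2 * cG z p"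
    using frame(8,9)[OF p]
    by (simp_all add: rodrigues[OF p] bounded_bilinear.minus_left[OF bounded_bilinear_mink]
        bounded_bilinear.minus_right[OF bounded_bilinear_mink] mink_simps cE_def cG_def power2_eq_square)
qed

lemma par_surf_derivatives:
  assumes p: "p \<in> D"
  shows "du (par_surf a z l) p = (1 - a * curv1 z l p) *\<^sub>R du z p"
    "dv (par_surf a z l) p = (1 - a * curv2 z l p) *\<^sub>R dv z p"
    "du (du (par_surf a z l)) p = du (du z) p + a *\<^sub>R du (du l) p"
    "dv (du (par_surf a z l)) p = dv (du z) p + a *\<^sub>R dv (du l) p"
    "dv (dv (par_surf a z l)) p = dv (dv z) p + a *\<^sub>R dv (dv l) p"
proof -
  note T = bounded_linear_scaleR_right[of a]
  note zD = Ck_on_2D(1-3)[OF z] and lD = Ck_on_2D(1-3)[OF l]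
  have S: "(\<lambda>q. a *\<^sub>R k q) differentiable_on D" if "k differentiable_on D" for k :: surf
    using that by (intro derivative_intros)
  have 1: "du (\<lambda>q. h q + a *\<^sub>R k q) q = du h q + a *\<^sub>R du k q"
    "dv (\<lambda>q. h q + a *\<^sub>R k q) q = dv h q + a *\<^sub>R dv k q"
    if "h differentiable_on D" "k differentiable_on D" "q \<in> D" for h k :: surf and q
    using du_add[OF that(1) S D(1), of k q] dv_add[OF that(1) S D(1), of k q]
      du_linear[OF T that(2) D(1), of q] dv_linear[OF T that(2) D(1), of q] that by simp_all
  note 2 = 1[OF zD(1) lD(1), folded par_surf_def]
  show "du (par_surf a z l) p = (1 - a * curv1 z l p) *\<^sub>R du z p"
    "dv (par_surf a z l) p = (1 - a * curv2 z l p) *\<^sub>R dv z p"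
    by (simp_all add: 2[OF p] rodrigues[OF p] algebra_simps)
  show "du (du (par_surf a z l)) p = du (du z) p + a *\<^sub>R du (du l) p"
    using du_cong[OF D(1) p 2(1)] 1[OF zD(2) lD(2) p] by simp
  show "dv (du (par_surf a z l)) p = dv (du z) p + a *\<^sub>R dv (du l) p"
    using dv_cong[OF D(1) p 2(1)] 1[OF zD(2) lD(2) p] by simp
  show "dv (dv (par_surf a z l)) p = dv (dv z) p + a *\<^sub>R dv (dv l) p"
    using dv_cong[OF D(1) p 2(2)] 1[OF zD(3) lD(3) p] by simp
qed

text \<open>The new L is L - a \<nu>_1^2 E, which factors because L = \<nu>_1 E. The coefficients
  are taken with respect to \<open>l\<close>; the sign of the normal is inserted later.\<close>

lemma par_surf_coeffs:
  assumes p: "p \<in> D"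
  shows "cE (par_surf a z l) p = (1 - a * curv1 z l p)\<^sup>2 * cE z p"
    "cF (par_surf a z l) p = 0"
    "cG (par_surf a z l) p = (1 - a * curv2 z l p)\<^sup>2 * cG z p"
    "cL (par_surf a z l) l p = (1 - a * curv1 z l p) * cL z l p"
    "cM (par_surf a z l) l p = 0"
    "cN (par_surf a z l) l p = (1 - a * curv2 z l p) * cN z l p"
proof -
  have "cL z l p = curv1 z l p * cE z p" "cN z l p = curv2 z l p * cG z p"
    using frame(6,7)[OF p] by (simp_all add: curv1_def curv2_def cE_def cG_def)
  then show "cL (par_surf a z l) l p = (1 - a * curv1 z l p) * cL z l p"
    "cN (par_surf a z l) l p = (1 - a * curv2 z l p) * cN z l p"
    using l_second_derivatives[OF p]
    by (simp_all add: cL_def cN_def par_surf_derivatives[OF p] mink_simps algebra_simps power2_eq_square)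
  show "cE (par_surf a z l) p = (1 - a * curv1 z l p)\<^sup>2 * cE z p"
    "cF (par_surf a z l) p = 0"
    "cG (par_surf a z l) p = (1 - a * curv2 z l p)\<^sup>2 * cG z p"
    "cM (par_surf a z l) l p = 0"
    using frame(8-10)[OF p] l_second_derivatives(2)[OF p]
    by (simp_all add: cE_def cF_def cG_def cM_def par_surf_derivatives[OF p] mink_simps power2_eq_square)
qed

end

section \<open>The parallel surface on the component of the base point\<close>

locale parallel_W_surface =
  fixes D :: "(real \<times> real) set" and z l :: surf
    and I :: "real set" and f g :: "real \<Rightarrow> real" and \<nu> :: "real \<times> real \<Rightarrow> real"
    and p0 :: "real \<times> real" and a :: real
  assumes natural: "natural_W_surface D z l I f g \<nu>"
    and p0: "p0 \<in> D" "(1 - a * curv1 z l p0) * (1 - a * curv2 z l p0) \<noteq> 0"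
begin

lemma W: "W_surface D z l I f g \<nu>" and natural_params: "natural_params D z I f g \<nu>"
  using natural by (auto simp: natural_W_surface_def)

lemma \<nu>: "Ck_on 2 D \<nu>" "p \<in> D \<Longrightarrow> \<nu> p \<in> I"
    "p \<in> D \<Longrightarrow> curv1 z l p = f (\<nu> p)" "p \<in> D \<Longrightarrow> curv2 z l p = g (\<nu> p)"
  using W by (auto simp: W_surface_def)

sublocale principal_surface D z l
  using W by unfold_locales (auto simp: W_surface_def)

sublocale weingarten_parallel I f g a "\<nu> p0"
  using W p0 \<nu>(2-4)[OF p0(1)] by unfold_locales (auto simp: W_surface_def)

definition D' where "D' = par_dom a D z l p0"

lemma par_dom_eq:
  "D' = connected_component_set {p \<in> D. (1 - a * f (\<nu> p)) * (1 - a * g (\<nu> p)) \<noteq> 0} p0"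
  unfolding D'_def par_dom_def using \<nu> by (intro arg_cong2[where f = connected_component_set] refl Collect_cong) auto

lemma D'_subset: "p \<in> D' \<Longrightarrow> p \<in> D"
  using connected_component_subset unfolding par_dom_eq by blast

lemma p0_in_D': "p0 \<in> D'"
  using p0 by (simp add: D'_def par_dom_def)

lemma connected_D': "connected D'"
  by (simp add: D'_def par_dom_def)

lemma open_D': "open D'"
proof -
  have "continuous_on D ((\<lambda>x. (1 - a * f x) * (1 - a * g x)) \<circ> \<nu>)"
    using \<nu>(2) by (intro continuous_on_compose Ck_on_2_continuous \<nu>(1)
        continuous_on_subset[OF continuous_singular]) auto
  then have "open (D \<inter> ((\<lambda>x. (1 - a * f x) * (1 - a * g x)) \<circ> \<nu>) -` (- {0}))"
    by (intro continuous_open_preimage D) auto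
  moreover have "D \<inter> ((\<lambda>x. (1 - a * f x) * (1 - a * g x)) \<circ> \<nu>) -` (- {0})
      = {p \<in> D. (1 - a * f (\<nu> p)) * (1 - a * g (\<nu> p)) \<noteq> 0}"
    by auto
  ultimately show ?thesis
    unfolding par_dom_eq by (metis open_connected_component)
qed

text \<open>The image of the connected set \<open>D'\<close> is connected, contains \<nu>(p0) and
  avoids the singular parameters, so it stays in one component. This carries the one-variable
  results over to the surface.\<close>

lemma \<nu>_in_J:
  assumes "p \<in> D'"
  shows "\<nu> p \<in> J"
proof -
  have "\<nu> ` D' \<subseteq> J"
    unfolding J_def par_interval_def
  proof (rule connected_component_maximal)
    show "connected (\<nu> ` D')"
      using D'_subset
      by (intro connected_continuous_image connected_D' continuous_on_subset[OF Ck_on_2_continuous[OF \<nu>(1)]]) auto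
    show "\<nu> p0 \<in> \<nu> ` D'" using p0_in_D' by simp
    show "\<nu> ` D' \<subseteq> {x \<in> I. (1 - a * f x) * (1 - a * g x) \<noteq> 0}"
      using connected_component_subset[of "{p \<in> D. (1 - a * f (\<nu> p)) * (1 - a * g (\<nu> p)) \<noteq> 0}" p0] \<nu>(2)
      unfolding par_dom_eq by auto
  qed
  then show ?thesis using assms by blast
qed

lemma D'_nonsingular:
  assumes "p \<in> D'"
  shows "1 - a * curv1 z l p \<noteq> 0" "1 - a * curv2 z l p \<noteq> 0"
  using nonsingular[OF \<nu>_in_J[OF assms]] \<nu>(3,4) D'_subset[OF assms] by auto

text \<open>With a constant sign, the new normal is a constant multiple of \<open>l\<close> and
  inherits its smoothness.\<close>

lemma par_normal_eq: "p \<in> D' \<Longrightarrow> par_normal a z l p = \<epsilon> *\<^sub>R l p"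
  using sgn_eq[OF \<nu>_in_J] \<nu>(3,4) D'_subset by (simp add: par_normal_def)

lemma par_normal_coeffs:
  assumes "p \<in> D'"
  shows "cL (par_surf a z l) (par_normal a z l) p = \<epsilon> * (1 - a * curv1 z l p) * cL z l p"
    "cM (par_surf a z l) (par_normal a z l) p = 0"
    "cN (par_surf a z l) (par_normal a z l) p = \<epsilon> * (1 - a * curv2 z l p) * cN z l p"
  using par_surf_coeffs(4-6)[OF D'_subset[OF assms], of a]
  by (simp_all add: cL_def cM_def cN_def par_normal_eq[OF assms] mink_simps)

lemma timelike_par_surf: "timelike_surface D' (par_surf a z l) (par_normal a z l)"
proof -
  have sub: "D' \<subseteq> D" using D'_subset by blast
  note smooth = Ck_on_linear[OF bounded_linear_scaleR_right open_D' Ck_on_subset[OF l sub]]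
  have "Ck_on 2 D' (par_surf a z l)"
    unfolding par_surf_def by (intro Ck_on_add open_D' Ck_on_subset[OF z sub] smooth)
  moreover have "Ck_on 2 D' (par_normal a z l)"
    using Ck_on_cong[OF open_D' smooth] par_normal_eq by metis
  moreover have "cE (par_surf a z l) p < 0" "cG (par_surf a z l) p > 0" if "p \<in> D'" for p
    unfolding par_surf_coeffs[OF D'_subset[OF that]]
    using frame(6,7)[OF D'_subset[OF that]] D'_nonsingular[OF that]
    by (auto simp: cE_def cG_def mult_pos_neg)
  moreover have "mink (par_normal a z l p) (par_normal a z l p) = 1"
    "mink (par_normal a z l p) (du (par_surf a z l) p) = 0"
    "mink (par_normal a z l p) (dv (par_surf a z l) p) = 0" if "p \<in> D'" for p
    using frame[OF D'_subset[OF that]]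
    by (simp_all add: par_normal_eq[OF that] par_surf_derivatives[OF D'_subset[OF that]] mink_simps)
  ultimately show ?thesis
    using open_D' connected_D' p0_in_D' by (auto simp: timelike_surface_def)
qed

text \<open>The curvature is \<epsilon> (1 - a \<nu>_1) L / ((1 - a \<nu>_1)^2 E) = \<epsilon>
  \<nu>_1 / (1 - a \<nu>_1), and similarly for \<nu>_2.\<close>

lemma par_surf_W_surface:
  "W_surface D' (par_surf a z l) (par_normal a z l) J (par_fun a f g) (par_fun a g f) \<nu>"
proof -
  have "curv1 (par_surf a z l) (par_normal a z l) p = par_fun a f g (\<nu> p)"
    "curv2 (par_surf a z l) (par_normal a z l) p = par_fun a g f (\<nu> p)" if "p \<in> D'" for p
    using D'_nonsingular[OF that]
    by (simp_all add: par_fun_eq[OF \<nu>_in_J[OF that]] \<nu>(3,4)[OF D'_subset[OF that], symmetric]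
        curv1_def[of "par_surf a z l"] curv2_def[of "par_surf a z l"] par_normal_coeffs[OF that]
        par_surf_coeffs[OF D'_subset[OF that]] power2_eq_square)
      (simp_all add: curv1_def curv2_def)
  moreover have "principal_params D' (par_surf a z l) (par_normal a z l)"
    using par_normal_coeffs(2) par_surf_coeffs(2) D'_subset by (auto simp: principal_params_def)
  ultimately show ?thesis
    using timelike_par_surf weingarten_par_fun Ck_on_subset[OF \<nu>(1) subsetI, OF D'_subset] \<nu>_in_J
    by (simp add: W_surface_def)
qed

lemma par_surf_natural_params:
  "natural_params D' (par_surf a z l) J (par_fun a f g) (par_fun a g f) \<nu>"
proof -
  interpret swapped: weingarten_parallel I g f a "\<nu> p0" by (rule swap)
  note swapped_exp = swapped.exp_wint_par_fun[unfolded J_swap]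
  have "(\<lambda>p. sqrt (- cE (par_surf a z l) p) * exp (wint J (par_fun a f g) (par_fun a g f) y (\<nu> p)))
      constant_on D'"
    "(\<lambda>p. sqrt (cG (par_surf a z l) p) * exp (wint J (par_fun a g f) (par_fun a f g) y (\<nu> p)))
      constant_on D'" if y: "y \<in> J" for y
  proof -
    have "(\<lambda>p. sqrt (- cE z p) * exp (wint I f g y (\<nu> p))) constant_on D"
      "(\<lambda>p. sqrt (cG z p) * exp (wint I g f y (\<nu> p))) constant_on D"
      using natural_params J_subset[OF y] by (simp_all add: natural_params_def)
    then obtain c d where c: "\<And>p. p \<in> D \<Longrightarrow> sqrt (- cE z p) * exp (wint I f g y (\<nu> p)) = c"
      and d: "\<And>p. p \<in> D \<Longrightarrow> sqrt (cG z p) * exp (wint I g f y (\<nu> p)) = d"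
      unfolding constant_on_def by blast
    \<comment> \<open>The factor |1 - a f(\<nu>)| from the square root cancels the denominator from
      the exponential; only its value at the lower limit \<open>y\<close> remains.\<close>
    have "sqrt (- cE (par_surf a z l) p) * exp (wint J (par_fun a f g) (par_fun a g f) y (\<nu> p))
        = c * \<bar>1 - a * f y\<bar>"
      "sqrt (cG (par_surf a z l) p) * exp (wint J (par_fun a g f) (par_fun a f g) y (\<nu> p))
        = d * \<bar>1 - a * g y\<bar>" if p: "p \<in> D'" for p
    proof -
      note pD = D'_subset[OF p]
      have "sqrt (- cE (par_surf a z l) p) = \<bar>1 - a * f (\<nu> p)\<bar> * sqrt (- cE z p)"
        "sqrt (cG (par_surf a z l) p) = \<bar>1 - a * g (\<nu> p)\<bar> * sqrt (cG z p)"
        by (simp_all only: par_surf_coeffs[OF pD] \<nu>(3,4)[OF pD] real_sqrt_mult real_sqrt_abs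
            mult_minus_right[symmetric])
      then show "sqrt (- cE (par_surf a z l) p) * exp (wint J (par_fun a f g) (par_fun a g f) y (\<nu> p))
          = c * \<bar>1 - a * f y\<bar>"
        "sqrt (cG (par_surf a z l) p) * exp (wint J (par_fun a g f) (par_fun a f g) y (\<nu> p))
          = d * \<bar>1 - a * g y\<bar>"
        using nonsingular[OF \<nu>_in_J[OF p]]
        unfolding exp_wint_par_fun[OF y \<nu>_in_J[OF p]] swapped_exp[OF y \<nu>_in_J[OF p]]
          c[OF pD, symmetric] d[OF pD, symmetric]
        by simp_all
    qed
    then show "(\<lambda>p. sqrt (- cE (par_surf a z l) p) * exp (wint J (par_fun a f g) (par_fun a g f) y (\<nu> p)))
        constant_on D'"
      "(\<lambda>p. sqrt (cG (par_surf a z l) p) * exp (wint J (par_fun a g f) (par_fun a f g) y (\<nu> p)))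
        constant_on D'"
      unfolding constant_on_def by blast+
  qed
  then show ?thesis by (simp add: natural_params_def)
qed

text \<open>The coefficients E and G of the two surfaces at the base point give the relations
  between squared constants required by \<open>same_pde_par_fun\<close>.\<close>

lemma par_surf_same_pde:
  "same_pde J (natural_pde z I f g \<nu> p0)
    (natural_pde (par_surf a z l) J (par_fun a f g) (par_fun a g f) \<nu> p0)"
  unfolding natural_pde_def
proof (rule same_pde_par_fun)
  have "cE z p0 < 0" "cG z p0 > 0"
    using frame[OF p0(1)] by (simp_all add: cE_def cG_def)
  moreover have "cE (par_surf a z l) p0 < 0" "cG (par_surf a z l) p0 > 0"
    using timelike_par_surf p0_in_D' by (auto simp: timelike_surface_def)
  ultimately
  show "(1 / sqrt (- cE (par_surf a z l) p0))\<^sup>2 = (1 / sqrt (- cE z p0))\<^sup>2 / (1 - a * f (\<nu> p0))\<^sup>2"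
    "(1 / sqrt (cG (par_surf a z l) p0))\<^sup>2 = (1 / sqrt (cG z p0))\<^sup>2 / (1 - a * g (\<nu> p0))\<^sup>2"
    by (simp_all add: power_divide par_surf_coeffs[OF p0(1)] \<nu>(3,4)[OF p0(1)])
qed

end

theorem theorem4p2:
  fixes D :: "(real \<times> real) set" and z l :: "real \<times> real \<Rightarrow> real^3"
    and I :: "real set" and f g :: "real \<Rightarrow> real" and \<nu> :: "real \<times> real \<Rightarrow> real"
    and p\<^sub>0 :: "real \<times> real" and a :: real
  assumes "natural_W_surface D z l I f g \<nu>"
    and "p\<^sub>0 \<in> D"
    and "a \<noteq> 0"
    and "(1 - a * curv1 z l p\<^sub>0) * (1 - a * curv2 z l p\<^sub>0) \<noteq> 0"
  shows "natural_W_surface (par_dom a D z l p\<^sub>0) (par_surf a z l) (par_normal a z l)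
           (par_interval a I f g (\<nu> p\<^sub>0)) (par_fun a f g) (par_fun a g f) \<nu> \<and>
         same_pde (par_interval a I f g (\<nu> p\<^sub>0))
           (natural_pde z I f g \<nu> p\<^sub>0)
           (natural_pde (par_surf a z l) (par_interval a I f g (\<nu> p\<^sub>0))
              (par_fun a f g) (par_fun a g f) \<nu> p\<^sub>0)"
proof -
  interpret parallel_W_surface D z l I f g \<nu> p\<^sub>0 a
    using assms by unfold_locales
  show ?thesis
    using par_surf_W_surface par_surf_natural_params par_surf_same_pde
    by (simp add: natural_W_surface_def D'_def J_def)
qed

end
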